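(* For every tree $T$ with $n$ vertices, $s_2(K_2,T)\le s_2(K_2,P_n)$, where $P_n$ is the path on $n$ vertices, and equality holds only if $T=P_n$ or $T=K_{1,3}$.
   Context: All graphs are finite and simple. The distance between two edges $e,e'$ of a graph $G$ is the minimum of $\mathrm{dist}_G(v,v')$ over vertices $v$ incident to $e$ and $v'$ incident to $e'$ (so two edges sharing a vertex have distance $0$). A $2$-matching (induced matching) in $G$ is a set of edges of $G$ such that any two distinct edges in the set have distance at least $2$; the empty set counts as one. $s_2(K_2,G)$ denotes the number of $2$-matchings in $G$. *)

theory Defs
  imports Main "HOL-Library.Extended_Nat"
begin

record 'a ugraph =
  verts :: "'a set"
  edges :: "'a set set"

definition simple_graph :: "'a ugraph \<Rightarrow> bool" where
  "simple_graph G \<longleftrightarrow>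
     finite (verts G) \<and> (\<forall>e \<in> edges G. e \<subseteq> verts G \<and> card e = 2)"

definition walk :: "'a ugraph \<Rightarrow> 'a list \<Rightarrow> bool" where
  "walk G p \<longleftrightarrow>
     p \<noteq> [] \<and> set p \<subseteq> verts G \<and> successively (\<lambda>u v. {u, v} \<in> edges G) p"

definition walk_betw :: "'a ugraph \<Rightarrow> 'a \<Rightarrow> 'a list \<Rightarrow> 'a \<Rightarrow> bool" where
  "walk_betw G u p v \<longleftrightarrow> walk G p \<and> hd p = u \<and> last p = v"

definition connected_graph :: "'a ugraph \<Rightarrow> bool" where
  "connected_graph G \<longleftrightarrow>
     verts G \<noteq> {} \<and> (\<forall>u \<in> verts G. \<forall>v \<in> verts G. \<exists>p. walk_betw G u p v)"

definition graph_cycle :: "'a ugraph \<Rightarrow> 'a list \<Rightarrow> bool" where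
  "graph_cycle G p \<longleftrightarrow>
     walk G p \<and> distinct p \<and> length p \<ge> 3 \<and> {last p, hd p} \<in> edges G"

definition tree :: "'a ugraph \<Rightarrow> bool" where
  "tree G \<longleftrightarrow> simple_graph G \<and> connected_graph G \<and> (\<nexists>p. graph_cycle G p)"

text \<open>A walk is the list of its vertices, so it has \<open>length p - 1\<close> edges; the infimum over the
  empty set gives distance \<open>\<infinity>\<close> between different components.\<close>

definition graph_dist :: "'a ugraph \<Rightarrow> 'a \<Rightarrow> 'a \<Rightarrow> enat" where
  "graph_dist G u v = (INF p \<in> {p. walk_betw G u p v}. enat (length p - 1))"

definition edge_dist :: "'a ugraph \<Rightarrow> 'a set \<Rightarrow> 'a set \<Rightarrow> enat" where
  "edge_dist G e e' = (INF v \<in> e. INF v' \<in> e'. graph_dist G v v')"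

definition two_matching :: "'a ugraph \<Rightarrow> 'a set set \<Rightarrow> bool" where
  "two_matching G M \<longleftrightarrow>
     M \<subseteq> edges G \<and> (\<forall>e \<in> M. \<forall>e' \<in> M. e \<noteq> e' \<longrightarrow> edge_dist G e e' \<ge> 2)"

definition num_two_matchings :: "'a ugraph \<Rightarrow> nat" where
  "num_two_matchings G = card {M. two_matching G M}"

definition path_graph :: "nat \<Rightarrow> nat ugraph" where
  "path_graph n = \<lparr> verts = {..<n}, edges = {{i, Suc i} | i. Suc i < n} \<rparr>"

definition complete_bipartite :: "nat \<Rightarrow> nat \<Rightarrow> nat ugraph" where
  "complete_bipartite a b =
     \<lparr> verts = {..<a + b}, edges = {{i, j} | i j. i < a \<and> a \<le> j \<and> j < a + b} \<rparr>"

definition graph_iso :: "'a ugraph \<Rightarrow> 'b ugraph \<Rightarrow> bool" where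
  "graph_iso G H \<longleftrightarrow>
     (\<exists>f. bij_betw f (verts G) (verts H) \<and>
          (\<forall>u \<in> verts G. \<forall>v \<in> verts G. {u, v} \<in> edges G \<longleftrightarrow> {f u, f v} \<in> edges H))"

end

theory Submission
  imports Defs
begin

text \<open>Let \<open>v\<close> be a leaf of a forest \<open>F\<close> with neighbour \<open>u\<close>. The 2-matchings of \<open>F\<close> that avoid the
  edge \<open>uv\<close> are those of \<open>F - v\<close>, and the ones that use it correspond to those of \<open>F - N[u]\<close>. For
  \<open>P\<^sub>n\<close> this gives \<open>a\<^sub>n = a\<^sub>n\<^sub>-\<^sub>1 + a\<^sub>n\<^sub>-\<^sub>3\<close>, and for a forest in which \<open>u\<close> has degree at least 2 the
  same recursion gives the bound by induction; if \<open>uv\<close> is an isolated edge, \<open>2 a\<^sub>n\<^sub>-\<^sub>2 \<le> a\<^sub>n\<close>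
  suffices. If a tree attains the bound, then so does \<open>T - v\<close>, and since \<open>a\<close> is strictly increasing
  from 1 on, for \<open>n \<ge> 5\<close> the neighbour of every leaf has degree exactly 2. Attaching a leaf to a
  path then yields a path again, and no leaf can be attached to \<open>K\<^sub>1\<^sub>,\<^sub>3\<close>.\<close>

section \<open>Neighbourhoods, vertex deletion and isomorphisms\<close>

definition neighbors :: "'a ugraph \<Rightarrow> 'a \<Rightarrow> 'a set" where
  "neighbors G u = {w. {u, w} \<in> edges G}"

definition delete_verts :: "'a ugraph \<Rightarrow> 'a set \<Rightarrow> 'a ugraph" where
  "delete_verts G S = \<lparr>verts = verts G - S, edges = {e \<in> edges G. e \<inter> S = {}}\<rparr>"

definition forest :: "'a ugraph \<Rightarrow> bool" where
  "forest G \<longleftrightarrow> simple_graph G \<and> (\<nexists>p. graph_cycle G p)"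

text \<open>Makes the map of \<open>graph_iso\<close> explicit, so that it can be composed and
  extended by one vertex, and so that one can say where the neighbour of a leaf is sent.\<close>

definition graph_isomorphism :: "('a \<Rightarrow> 'b) \<Rightarrow> 'a ugraph \<Rightarrow> 'b ugraph \<Rightarrow> bool" where
  "graph_isomorphism f G H \<longleftrightarrow> bij_betw f (verts G) (verts H) \<and>
     (\<forall>u \<in> verts G. \<forall>v \<in> verts G. {u, v} \<in> edges G \<longleftrightarrow> {f u, f v} \<in> edges H)"

lemma graph_iso_iff: "graph_iso G H \<longleftrightarrow> (\<exists>f. graph_isomorphism f G H)"
  by (simp add: graph_iso_def graph_isomorphism_def)

lemma verts_delete_verts [simp]: "verts (delete_verts G S) = verts G - S"
  and edges_delete_verts [simp]: "edges (delete_verts G S) = {e \<in> edges G. e \<inter> S = {}}"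
  by (simp_all add: delete_verts_def)

lemma mem_neighbors_iff [simp]: "w \<in> neighbors G u \<longleftrightarrow> {u, w} \<in> edges G"
  by (simp add: neighbors_def)

lemma simple_graph_edgeD:
  assumes "simple_graph G" "{x, y} \<in> edges G"
  shows "x \<in> verts G" "y \<in> verts G" "x \<noteq> y"
  using assms by (auto simp: simple_graph_def)

lemma simple_graph_edgeE:
  assumes "simple_graph G" "e \<in> edges G"
  obtains x y where "e = {x, y}" "x \<noteq> y"
  using assms by (auto simp: simple_graph_def card_2_iff)

lemma simple_graph_edge_other_end:
  assumes "simple_graph G" "e \<in> edges G" "v \<in> e"
  obtains w where "e = {v, w}" "w \<in> neighbors G v"
proof -
  obtain x y where "e = {x, y}" using assms(1,2) by (rule simple_graph_edgeE)
  then have "e = {v, if v = x then y else x}" using assms(3) by auto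
  then show ?thesis using that assms(2) by auto
qed

lemma simple_graph_finite_edges: "simple_graph G \<Longrightarrow> finite (edges G)"
  by (rule finite_subset[of _ "Pow (verts G)"]) (auto simp: simple_graph_def)

lemma simple_graph_neighbors:
  assumes "simple_graph G"
  shows "neighbors G u \<subseteq> verts G - {u}" "finite (neighbors G u)"
proof -
  show "neighbors G u \<subseteq> verts G - {u}"
  proof
    fix w assume "w \<in> neighbors G u"
    then have "{u, w} \<in> edges G" by simp
    from simple_graph_edgeD[OF assms this] show "w \<in> verts G - {u}" by simp
  qed
  then show "finite (neighbors G u)"
    using assms by (auto simp: simple_graph_def intro: finite_subset)
qed

lemma leaf_edge_iff:
  assumes "neighbors G v = {u}"
  shows "{v, w} \<in> edges G \<longleftrightarrow> w = u" "{w, v} \<in> edges G \<longleftrightarrow> w = u"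
proof -
  have "w \<in> neighbors G v \<longleftrightarrow> w = u" unfolding assms by simp
  then show "{v, w} \<in> edges G \<longleftrightarrow> w = u" "{w, v} \<in> edges G \<longleftrightarrow> w = u"
    by (simp_all add: insert_commute)
qed

lemma leafD:
  assumes "simple_graph G" "neighbors G v = {u}"
  shows "u \<in> verts G" "v \<in> verts G" "u \<noteq> v" "{u, v} \<in> edges G"
proof -
  show e: "{u, v} \<in> edges G" by (simp add: leaf_edge_iff[OF assms(2)])
  show "u \<in> verts G" "v \<in> verts G" "u \<noteq> v"
    using simple_graph_edgeD[OF assms(1) e] by auto
qed

lemma leaf_edgeD:
  assumes "simple_graph G" "neighbors G v = {u}" "e \<in> edges G" "v \<in> e"
  shows "e = {u, v}"
proof -
  obtain w where "e = {v, w}" "w \<in> neighbors G v"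
    using assms(1,3,4) by (rule simple_graph_edge_other_end)
  then show ?thesis unfolding assms(2) by auto
qed

lemma simple_graph_delete_verts: "simple_graph G \<Longrightarrow> simple_graph (delete_verts G S)"
  by (auto simp: simple_graph_def)

lemma walk_delete_vertsD: "walk (delete_verts G S) p \<Longrightarrow> walk G p"
  unfolding walk_def by (auto elim!: successively_mono)

lemma forest_delete_verts: "forest G \<Longrightarrow> forest (delete_verts G S)"
  unfolding forest_def graph_cycle_def
  using walk_delete_vertsD[of G S] simple_graph_delete_verts[of G S] by auto

lemma graph_isomorphism_trans:
  assumes "graph_isomorphism f G H" "graph_isomorphism g H K"
  shows "graph_isomorphism (g \<circ> f) G K"
  using assms bij_betw_apply[of f "verts G" "verts H"]
  by (simp add: graph_isomorphism_def) (blast intro: bij_betw_trans)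

lemma graph_isomorphism_delete_vertD:
  assumes "graph_isomorphism f (delete_verts G {v}) H"
  shows "bij_betw f (verts G - {v}) (verts H)"
    and "x \<in> verts G - {v} \<Longrightarrow> y \<in> verts G - {v} \<Longrightarrow>
      {x, y} \<in> edges G \<longleftrightarrow> {f x, f y} \<in> edges H"
  using assms by (auto simp: graph_isomorphism_def)

text \<open>A leaf is determined by the vertex that it hangs at, so an isomorphism between the
  graphs without the leaves extends as soon as it sends one attachment vertex to the other. This
  rebuilds a tree from \<open>T - v\<close>.\<close>

lemma graph_isomorphism_add_leaf:
  assumes "simple_graph G" "neighbors G v = {u}"
    and "simple_graph H" "neighbors H k = {f u}"
    and iso: "graph_isomorphism f (delete_verts G {v}) (delete_verts H {k})"
  shows "graph_isomorphism (f(v := k)) G H"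
proof -
  have v: "v \<in> verts G" "u \<noteq> v" "u \<in> verts G" and k: "k \<in> verts H"
    using leafD[OF assms(1,2)] leafD[OF assms(3,4)] by auto
  have bij: "bij_betw f (verts G - {v}) (verts H - {k})"
    and adj: "\<And>x y. x \<in> verts G - {v} \<Longrightarrow> y \<in> verts G - {v} \<Longrightarrow>
      {x, y} \<in> edges G \<longleftrightarrow> {f x, f y} \<in> edges H \<and> f x \<noteq> k \<and> f y \<noteq> k"
    using iso by (auto simp: graph_isomorphism_def)
  have f: "f x \<noteq> k" "f x = f u \<longleftrightarrow> x = u" if "x \<in> verts G" "x \<noteq> v" for x
    using bij that v by (auto simp: bij_betw_def inj_on_def)
  have "bij_betw (f(v := k)) (verts G) (verts H)"
  proof -
    have "bij_betw (f(v := k)) (verts G - {v}) (verts H - {k})"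
      using bij by (rule bij_betw_cong[THEN iffD1, rotated]) simp
    then have "bij_betw (f(v := k)) (verts G - {v} \<union> {v}) (verts H - {k} \<union> {(f(v := k)) v})"
      by (intro notIn_Un_bij_betw) auto
    then show ?thesis using v k by (simp add: insert_absorb)
  qed
  moreover have "{x, y} \<in> edges G \<longleftrightarrow> {(f(v := k)) x, (f(v := k)) y} \<in> edges H"
    if "x \<in> verts G" "y \<in> verts G" for x y
  proof -
    \<comment> \<open>For \<open>x = y = v\<close> the pair collapses to a singleton, which is no
      edge on either side.\<close>
    have "{v} \<notin> edges G" "{k} \<notin> edges H"
      using assms(1,3) by (auto simp: simple_graph_def)
    then show ?thesis
      using that adj[of x y] f[of x] f[of y]
      by (cases "x = v"; cases "y = v") (auto simp: leaf_edge_iff[OF assms(2)] leaf_edge_iff[OF assms(4)])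
  qed
  ultimately show ?thesis by (auto simp: graph_isomorphism_def)
qed

section \<open>Leaves of forests and trees\<close>

text \<open>Longest-path argument: the first vertex of a longest path has no neighbour but the
  second one, since a neighbour off the path would lengthen it and a later one on it would close a
  cycle.\<close>

lemma forest_leafE:
  assumes "forest G" "edges G \<noteq> {}"
  obtains u v where "neighbors G v = {u}"
proof -
  have sg: "simple_graph G" using assms by (simp add: forest_def)
  let ?P = "\<lambda>p. walk G p \<and> distinct p"
  obtain e where "e \<in> edges G" using assms(2) by blast
  then obtain x y where e: "{x, y} \<in> edges G"
    using simple_graph_edgeE[OF sg] by metis
  then have xy: "?P [x, y]"
    using simple_graph_edgeD[OF sg e] by (simp add: walk_def)
  \<comment> \<open>A path repeats no vertex, so lengths are bounded and a longest path
    exists.\<close>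
  have bound: "length p < Suc (card (verts G))" if "?P p" for p
    using that sg card_mono[of "verts G" "set p"]
    by (auto simp: walk_def simple_graph_def distinct_card)
  obtain p where p: "?P p" and max: "\<And>q. ?P q \<Longrightarrow> length q \<le> length p"
    using ex_has_greatest_nat[of ?P, OF xy, of length] bound by blast
  have "length p \<ge> 2" using max[OF xy] by simp
  then obtain v u q where pq: "p = v # u # q"
    by (cases p; cases "tl p") auto
  have "w = u" if w: "{v, w} \<in> edges G" for w
  proof (rule ccontr)
    assume "w \<noteq> u"
    have wv: "w \<in> verts G" "w \<noteq> v" using simple_graph_edgeD[OF sg w] by auto
    show False
    proof (cases "w \<in> set q")
      case False
      then have "?P (w # p)"
        using p pq w wv \<open>w \<noteq> u\<close> by (auto simp: walk_def insert_commute)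
      then show False using max[of "w # p"] by simp
    next
      case True
      then obtain q1 q2 where q: "q = q1 @ w # q2" by (meson split_list)
      \<comment> \<open>The initial piece of \<open>p\<close> up to \<open>w\<close>, closed by the
        edge \<open>{v, w}\<close>, is a cycle; it has at least the three vertices \<open>v\<close>,
        \<open>u\<close>, \<open>w\<close>.\<close>
      have "p = (v # u # q1 @ [w]) @ q2" using pq q by simp
      then have "graph_cycle G (v # u # q1 @ [w])"
        using p w unfolding graph_cycle_def walk_def
        by (auto simp: successively_append_iff insert_commute simp del: append_Cons)
      then show False using assms by (auto simp: forest_def)
    qed
  qed
  moreover have "{v, u} \<in> edges G" using p pq by (simp add: walk_def)
  ultimately have "neighbors G v = {u}" unfolding neighbors_def by blast
  then show ?thesis by (rule that)
qed

lemma tree_imp_forest: "tree G \<Longrightarrow> forest G"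
  by (simp add: tree_def forest_def)

lemma tree_delete_leaf:
  assumes "tree G" "neighbors G v = {u}"
  shows "tree (delete_verts G {v})"
proof -
  let ?H = "delete_verts G {v}"
  have sg: "simple_graph G" using assms by (simp add: tree_def)
  have u: "u \<in> verts G" "u \<noteq> v"
    using leafD[OF sg assms(2)] by auto
  \<comment> \<open>A walk can be pushed into \<open>G - v\<close> by projecting \<open>v\<close> onto \<open>u\<close>.\<close>
  have *: "walk G p \<Longrightarrow> hd p = x \<Longrightarrow> x \<noteq> v \<Longrightarrow>
      \<exists>q. walk_betw ?H x q (if last p = v then u else last p)" for p x
  proof (induction p rule: rev_induct)
    case Nil
    then show ?case by (simp add: walk_def)
  next
    case (snoc y p)
    show ?case
    proof (cases "p = []")
      case True
      then show ?thesis
        using snoc.prems by (auto simp: walk_def walk_betw_def intro!: exI[of _ "[x]"])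
    next
      case False
      then have p: "walk G p" "hd p = x" "{last p, y} \<in> edges G" "y \<in> verts G"
        using snoc.prems by (auto simp: walk_def successively_append_iff)
      then obtain q where q: "walk_betw ?H x q (if last p = v then u else last p)"
        using snoc by blast
      \<comment> \<open>The last step enters \<open>v\<close>, leaves \<open>v\<close> or avoids
        \<open>v\<close>. In the first two cases the projected end stays at \<open>u\<close>, so
        \<open>q\<close> is kept; only in the third is \<open>q\<close> extended.\<close>
      consider "y = v" "last p = u" | "y = u" "last p = v" | "y \<noteq> v" "last p \<noteq> v"
        using p(3) leaf_edge_iff[OF assms(2)] by metis
      then show ?thesis
      proof cases
        case 3
        then have "walk_betw ?H x (q @ [y]) y"
          using q p by (auto simp: walk_betw_def walk_def successively_append_iff)
        then show ?thesis using 3 by auto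
      qed (use q u in auto)
    qed
  qed
  have "connected_graph ?H"
    unfolding connected_graph_def
  proof (intro conjI ballI)
    show "verts ?H \<noteq> {}" using u by auto
    fix x y assume xy: "x \<in> verts ?H" "y \<in> verts ?H"
    then obtain p where "walk_betw G x p y"
      using assms(1) unfolding tree_def connected_graph_def verts_delete_verts by blast
    then show "\<exists>p. walk_betw ?H x p y"
      using *[of p x] xy by (auto simp: walk_betw_def)
  qed
  then show ?thesis
    using forest_delete_verts[of G "{v}"] tree_imp_forest[OF assms(1)]
    by (simp add: tree_def forest_def)
qed

lemma tree_neighbors_nonempty:
  assumes "tree G" "u \<in> verts G" "2 \<le> card (verts G)"
  shows "neighbors G u \<noteq> {}"
proof -
  have "\<not> verts G \<subseteq> {u}"
    using card_mono[of "{u}" "verts G"] assms(3) by auto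
  then obtain x where x: "x \<in> verts G" "x \<noteq> u" by blast
  obtain p where "walk_betw G u p x"
    using assms x unfolding tree_def connected_graph_def by blast
  then have p: "walk G p" "hd p = u" "last p = x"
    by (auto simp: walk_betw_def)
  then obtain y q where "p = u # y # q"
    using x by (cases p; cases "tl p") (auto simp: walk_def)
  then have "y \<in> neighbors G u" using p by (auto simp: walk_def)
  then show ?thesis by blast
qed

text \<open>\<open>T - v\<close> is a tree with at least two vertices, so \<open>u\<close> still has
  a neighbour in it, besides \<open>v\<close>.\<close>

lemma tree_leaf_neighbor_degree:
  assumes "tree G" "neighbors G v = {u}" "3 \<le> card (verts G)"
  shows "2 \<le> card (neighbors G u)"
proof -
  have sg: "simple_graph G" using assms by (simp add: tree_def)
  have u: "u \<in> verts G" "u \<noteq> v" "v \<in> verts G" "{u, v} \<in> edges G"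
    using leafD[OF sg assms(2)] by auto
  have "neighbors (delete_verts G {v}) u \<noteq> {}"
    using u assms(3) by (intro tree_neighbors_nonempty tree_delete_leaf[OF assms(1,2)]) auto
  then obtain w where "w \<in> neighbors G u" "w \<noteq> v" by fastforce
  then have "{v, w} \<subseteq> neighbors G u" "card {v, w} = 2" using u by auto
  then show ?thesis
    by (metis card_mono simple_graph_neighbors(2)[OF sg])
qed

section \<open>Counting 2-matchings\<close>

text \<open>Only walks with one or two vertices are shorter than 2, and these are \<open>[u]\<close>
  and \<open>[u, v]\<close>.\<close>

lemma two_le_graph_dist_iff:
  assumes "u \<in> verts G" "v \<in> verts G"
  shows "2 \<le> graph_dist G u v \<longleftrightarrow> u \<noteq> v \<and> {u, v} \<notin> edges G"
proof -
  have "2 \<le> graph_dist G u v \<longleftrightarrow> (\<forall>p. walk_betw G u p v \<longrightarrow> 3 \<le> length p)"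
    by (auto simp: graph_dist_def le_INF_iff numeral_eq_enat)
  also have "\<dots> \<longleftrightarrow> u \<noteq> v \<and> {u, v} \<notin> edges G"
  proof
    assume *: "\<forall>p. walk_betw G u p v \<longrightarrow> 3 \<le> length p"
    show "u \<noteq> v \<and> {u, v} \<notin> edges G"
      using *[rule_format, of "[u]"] *[rule_format, of "[u, v]"] assms
      by (auto simp: walk_betw_def walk_def)
  next
    assume *: "u \<noteq> v \<and> {u, v} \<notin> edges G"
    show "\<forall>p. walk_betw G u p v \<longrightarrow> 3 \<le> length p"
    proof (intro allI impI)
      fix p assume "walk_betw G u p v"
      then show "3 \<le> length p"
        using * by (cases p; cases "tl p"; cases "tl (tl p)") (auto simp: walk_betw_def walk_def)
    qed
  qed
  finally show ?thesis .
qed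

text \<open>Turns distance into adjacency. Deleting vertices can increase distances, but it leaves
  adjacency among the remaining vertices unchanged, so this form compares well between a graph and
  its induced subgraphs.\<close>

lemma two_matching_iff:
  assumes "simple_graph G"
  shows "two_matching G M \<longleftrightarrow> M \<subseteq> edges G \<and>
    (\<forall>e \<in> M. \<forall>e' \<in> M. e \<noteq> e' \<longrightarrow> (\<forall>x \<in> e. \<forall>y \<in> e'. x \<noteq> y \<and> {x, y} \<notin> edges G))"
proof -
  have "2 \<le> edge_dist G e e' \<longleftrightarrow> (\<forall>x \<in> e. \<forall>y \<in> e'. x \<noteq> y \<and> {x, y} \<notin> edges G)"
    if "e \<in> edges G" "e' \<in> edges G" for e e'
  proof -
    have "e \<subseteq> verts G" "e' \<subseteq> verts G" using assms that by (auto simp: simple_graph_def)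
    then show ?thesis
      unfolding edge_dist_def le_INF_iff using two_le_graph_dist_iff[of _ G] by blast
  qed
  then show ?thesis unfolding two_matching_def by (meson subsetD)
qed

lemma two_matching_pairD:
  assumes "simple_graph G" "two_matching G M" "e \<in> M" "e' \<in> M" "e \<noteq> e'" "x \<in> e" "y \<in> e'"
  shows "x \<noteq> y" "{x, y} \<notin> edges G"
proof -
  have "\<forall>x \<in> e. \<forall>y \<in> e'. x \<noteq> y \<and> {x, y} \<notin> edges G"
    using assms(2-5) unfolding two_matching_iff[OF assms(1)] by metis
  then show "x \<noteq> y" "{x, y} \<notin> edges G" using assms(6,7) by auto
qed

lemma two_matching_subset: "two_matching G M \<Longrightarrow> M \<subseteq> edges G"
  by (simp add: two_matching_def)

lemma finite_two_matchings: "simple_graph G \<Longrightarrow> finite {M. two_matching G M}"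
  by (rule finite_subset[of _ "Pow (edges G)"])
    (auto simp: two_matching_def simple_graph_finite_edges)

lemma num_two_matchings_pos:
  assumes "simple_graph G"
  shows "0 < num_two_matchings G"
proof -
  have "{} \<in> {M. two_matching G M}" by (simp add: two_matching_def)
  then show ?thesis
    unfolding num_two_matchings_def using finite_two_matchings[OF assms] card_gt_0_iff by blast
qed

lemma num_two_matchings_no_edges: "edges G = {} \<Longrightarrow> num_two_matchings G = 1"
  by (simp add: num_two_matchings_def two_matching_def conj_commute cong: conj_cong)

text \<open>Isolated vertices do not affect the count. This matters for an isolated edge, where
  deleting one end or both leaves the same edges.\<close>

lemma num_two_matchings_cong_edges:
  assumes "simple_graph G" "simple_graph H" "edges G = edges H"
  shows "num_two_matchings G = num_two_matchings H"
  by (simp add: num_two_matchings_def two_matching_iff assms)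

text \<open>\<open>{u, v}\<close> is the only edge at \<open>v\<close>, so a set of edges without it
  never meets \<open>v\<close>.\<close>

lemma two_matching_avoiding_leaf_iff:
  assumes "simple_graph G" "neighbors G v = {u}"
  shows "two_matching G M \<and> {u, v} \<notin> M \<longleftrightarrow> two_matching (delete_verts G {v}) M"
proof -
  have v: "v \<notin> e" if "e \<in> M" "M \<subseteq> edges G" "{u, v} \<notin> M" for e
    using that leaf_edgeD[OF assms, of e] by auto
  have "two_matching G M \<longleftrightarrow> two_matching (delete_verts G {v}) M"
    if M: "M \<subseteq> edges G" "{u, v} \<notin> M"
  proof -
    have "{x, y} \<in> edges G \<longleftrightarrow> {x, y} \<in> edges (delete_verts G {v})"
      if "e \<in> M" "e' \<in> M" "x \<in> e" "y \<in> e'" for e e' x y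
      using v[OF that(1) M] v[OF that(2) M] that(3,4) by auto
    moreover have "M \<subseteq> edges (delete_verts G {v})"
      using v[OF _ M] M by auto
    ultimately show ?thesis
      unfolding two_matching_iff[OF assms(1)]
        two_matching_iff[OF simple_graph_delete_verts[OF assms(1)]]
      using M(1) by (metis (no_types, lifting))
  qed
  moreover have "M \<subseteq> edges G \<and> {u, v} \<notin> M" if "two_matching (delete_verts G {v}) M"
    using that by (auto simp: two_matching_def)
  moreover have "M \<subseteq> edges G" if "two_matching G M"
    using that by (simp add: two_matching_def)
  ultimately show ?thesis by blast
qed

text \<open>An edge is compatible with \<open>{u, v}\<close> exactly if it misses the closed
  neighbourhood of \<open>u\<close>: the other end \<open>v\<close> lies in it, and the only
  neighbour of \<open>v\<close> is \<open>u\<close>.\<close>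

lemma two_matching_insert_leaf_iff:
  assumes "simple_graph G" "neighbors G v = {u}" "{u, v} \<notin> M"
  shows "two_matching G (insert {u, v} M) \<longleftrightarrow>
    two_matching (delete_verts G (insert u (neighbors G u))) M" (is "?L \<longleftrightarrow> ?R")
proof
  let ?N = "insert u (neighbors G u)"
  have sg: "simple_graph (delete_verts G ?N)"
    by (rule simple_graph_delete_verts[OF assms(1)])
  {
    assume L: ?L
    have disj: "e \<inter> ?N = {}" if e: "e \<in> M" for e
    proof -
      have "u \<noteq> x" "{u, x} \<notin> edges G" if "x \<in> e" for x
        using two_matching_pairD[OF assms(1) L, of "{u, v}" e u x] e that assms(3) by auto
      then show ?thesis by auto
    qed
    show ?R
      unfolding two_matching_iff[OF sg]
    proof (intro conjI ballI impI)
      show "M \<subseteq> edges (delete_verts G ?N)"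
        using two_matching_subset[OF L] disj by auto
      fix e e' x y
      assume *: "e \<in> M" "e' \<in> M" "e \<noteq> e'" "x \<in> e" "y \<in> e'"
      show "x \<noteq> y" "{x, y} \<notin> edges (delete_verts G ?N)"
        using two_matching_pairD[OF assms(1) L, of e e' x y] * by auto
    qed
  }
  assume R: ?R
  have e: "e \<in> edges G" "e \<inter> ?N = {}" if "e \<in> M" for e
    using two_matching_subset[OF R] that by auto
  have pairs: "x \<noteq> y \<and> {x, y} \<notin> edges G"
    if "e \<in> M" "e' \<in> M" "e \<noteq> e'" "x \<in> e" "y \<in> e'" for e e' x y
  proof -
    \<comment> \<open>Neither end was deleted, so an edge \<open>{x, y}\<close> of \<open>G\<close>
      would survive in the smaller graph.\<close>
    have "{x, y} \<inter> ?N = {}" using e(2)[OF that(1)] e(2)[OF that(2)] that(4,5) by blast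
    then show ?thesis using two_matching_pairD[OF sg R that] by auto
  qed
  have uv: "x \<noteq> y \<and> {x, y} \<notin> edges G \<and> {y, x} \<notin> edges G"
    if "e \<in> M" "x \<in> e" "y \<in> {u, v}" for e x y
  proof -
    have x: "x \<noteq> u" "{u, x} \<notin> edges G" using e(2)[OF that(1)] that(2) by auto
    show ?thesis
    proof (cases "y = u")
      case True
      then show ?thesis using x by (simp add: insert_commute)
    next
      case False
      then have "y = v" using that(3) by simp
      then show ?thesis
        using x leafD(4)[OF assms(1,2)] by (auto simp: leaf_edge_iff[OF assms(2)])
    qed
  qed
  have "{u, v} \<in> edges G" by (simp add: leaf_edge_iff[OF assms(2)])
  then show ?L
    unfolding two_matching_iff[OF assms(1)]
  proof (intro conjI ballI impI)
    fix e e' x y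
    assume "e \<in> insert {u, v} M" "e' \<in> insert {u, v} M" "e \<noteq> e'" and xy: "x \<in> e" "y \<in> e'"
    then consider "e \<in> M" "e' \<in> M" "e \<noteq> e'" | "e \<in> M" "e' = {u, v}" | "e = {u, v}" "e' \<in> M"
      by blast
    then have "x \<noteq> y \<and> {x, y} \<notin> edges G"
    proof cases
      case 1
      then show ?thesis using pairs xy by blast
    next
      case 2
      then show ?thesis using uv[of e x y] xy by simp
    next
      case 3
      then show ?thesis using uv[of e' y x] xy by auto
    qed
    then show "x \<noteq> y" "{x, y} \<notin> edges G" by auto
  qed (use e(1) in auto)
qed

text \<open>The two kinds of 2-matchings are disjoint, and inserting \<open>{u, v}\<close> is
  injective because no 2-matching of the second graph contains it.\<close>

lemma num_two_matchings_leaf: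
  assumes "simple_graph G" "neighbors G v = {u}"
  shows "num_two_matchings G = num_two_matchings (delete_verts G {v}) +
    num_two_matchings (delete_verts G (insert u (neighbors G u)))"
proof -
  let ?e = "{u, v}" and ?H = "delete_verts G (insert u (neighbors G u))"
  have notin: "?e \<notin> M" if "two_matching ?H M" for M
    using two_matching_subset[OF that] by auto
  have split: "{M. two_matching G M} =
      {M. two_matching (delete_verts G {v}) M} \<union> insert ?e ` {M. two_matching ?H M}"
  proof (intro set_eqI iffI)
    fix M assume "M \<in> {M. two_matching G M}"
    then have M: "two_matching G M" by simp
    show "M \<in> {M. two_matching (delete_verts G {v}) M} \<union> insert ?e ` {M. two_matching ?H M}"
    proof (cases "?e \<in> M")
      case True
      then have "two_matching ?H (M - {?e})"
        using M two_matching_insert_leaf_iff[OF assms, of "M - {?e}"] by (simp add: insert_absorb)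
      moreover have "M = insert ?e (M - {?e})" using True by blast
      ultimately show ?thesis by blast
    qed (simp add: M flip: two_matching_avoiding_leaf_iff[OF assms])
  next
    fix M assume "M \<in> {M. two_matching (delete_verts G {v}) M} \<union> insert ?e ` {M. two_matching ?H M}"
    then consider "two_matching (delete_verts G {v}) M"
      | M' where "two_matching ?H M'" "M = insert ?e M'" by blast
    then show "M \<in> {M. two_matching G M}"
    proof cases
      case 1
      then show ?thesis by (simp flip: two_matching_avoiding_leaf_iff[OF assms])
    next
      case 2
      then show ?thesis by (simp add: two_matching_insert_leaf_iff[OF assms notin])
    qed
  qed
  have "{M. two_matching (delete_verts G {v}) M} \<inter> insert ?e ` {M. two_matching ?H M} = {}"
  proof -
    have "?e \<notin> M" if "two_matching (delete_verts G {v}) M" for M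
      using that by (simp flip: two_matching_avoiding_leaf_iff[OF assms])
    then show ?thesis by blast
  qed
  moreover have "inj_on (insert ?e) {M. two_matching ?H M}"
    using notin by (intro inj_onI) (metis insert_ident mem_Collect_eq)
  ultimately show ?thesis
    unfolding num_two_matchings_def split
    by (simp add: card_Un_disjoint card_image finite_two_matchings simple_graph_delete_verts assms(1))
qed

section \<open>Paths\<close>

abbreviation path_count :: "nat \<Rightarrow> nat" where
  "path_count n \<equiv> num_two_matchings (path_graph n)"

lemma verts_path_graph [simp]: "verts (path_graph n) = {..<n}"
  by (simp add: path_graph_def)

lemma path_graph_edge_iff [simp]:
  "{x, y} \<in> edges (path_graph n) \<longleftrightarrow> (y = Suc x \<and> y < n) \<or> (x = Suc y \<and> x < n)"
  by (auto simp: path_graph_def doubleton_eq_iff)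

lemma simple_graph_path_graph: "simple_graph (path_graph n)"
  by (auto simp: simple_graph_def path_graph_def)

lemma path_graph_delete_last: "delete_verts (path_graph n) {m..<n} = path_graph (min m n)"
  by (auto simp: delete_verts_def path_graph_def)

lemma path_count_0 [simp]: "path_count 0 = 1"
  and path_count_1 [simp]: "path_count (Suc 0) = 1"
  by (auto simp: num_two_matchings_no_edges path_graph_def)

text \<open>The truncated difference makes \<open>n = 2\<close> follow the same recursion.\<close>
lemma path_count_rec:
  assumes "2 \<le> n"
  shows "path_count n = path_count (n - 1) + path_count (n - 3)"
proof -
  have "neighbors (path_graph n) (n - 1) = {n - 2}"
    using assms by auto
  moreover have "delete_verts (path_graph n) {n - 1} = path_graph (n - 1)"
    using path_graph_delete_last[of n "n - 1"] assms
    by (metis Suc_diff_1 atLeastLessThan_singleton diff_le_self less_le_trans min.absorb1 pos2)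
  moreover have "delete_verts (path_graph n) (insert (n - 2) (neighbors (path_graph n) (n - 2))) =
      path_graph (n - 3)"
  proof -
    \<comment> \<open>For \<open>n = 2\<close> the vertex \<open>n - 2\<close> is the end 0 and has
      no predecessor; \<open>n - 3\<close> truncates to 0, so the interval is still correct.\<close>
    have "insert (n - 2) (neighbors (path_graph n) (n - 2)) = {n - 3..<n}"
      using assms by auto
    then show ?thesis using path_graph_delete_last[of n "n - 3"] by simp
  qed
  ultimately show ?thesis
    using num_two_matchings_leaf[OF simple_graph_path_graph, of n "n - 1" "n - 2"] by simp
qed

lemma path_count_pos: "0 < path_count n"
  by (simp add: num_two_matchings_pos simple_graph_path_graph)

text \<open>The increase is \<open>path_count (n - 2)\<close>, which is positive. Strictness begins
  at 1 because \<open>path_count 0\<close> and \<open>path_count 1\<close> are both 1.\<close>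

lemma path_count_Suc_less: "1 \<le> n \<Longrightarrow> path_count n < path_count (Suc n)"
  using path_count_rec[of "Suc n"] path_count_pos[of "Suc n - 3"] by simp

lemma path_count_mono: "m \<le> n \<Longrightarrow> path_count m \<le> path_count n"
proof (rule lift_Suc_mono_le[of path_count])
  show "path_count n \<le> path_count (Suc n)" for n
    using path_count_Suc_less[of n] by (cases "n = 0") auto
qed

text \<open>Writing a_n for the count, a_{n+2} = a_n + a_{n-2} + a_{n-1}, while a_n = a_{n-1} +
  a_{n-3} is at most a_{n-1} + a_{n-2}. The values 0 and 1 of \<open>n\<close> are checked
  directly.\<close>

lemma twice_path_count_le: "2 * path_count n \<le> path_count (n + 2)"
proof -
  have 1: "path_count (n + 2) = path_count (n + 1) + path_count (n - 1)"
    using path_count_rec[of "n + 2"] by simp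
  show ?thesis
  proof (cases "n \<ge> 2")
    case True
    then have "path_count (n + 1) = path_count n + path_count (n - 2)"
      "path_count n = path_count (n - 1) + path_count (n - 3)"
      using path_count_rec[of "n + 1"] path_count_rec[of n] by simp_all
    moreover have "path_count (n - 3) \<le> path_count (n - 2)"
      by (intro path_count_mono) simp
    ultimately show ?thesis using 1 by simp
  next
    case False
    then have "n = 0 \<or> n = 1" by auto
    then show ?thesis
      using 1 path_count_rec[of 2] by (auto simp: numeral_2_eq_2)
  qed
qed

section \<open>The bound for forests\<close>

lemma card_delete_closed_neighborhood:
  assumes "simple_graph G" "u \<in> verts G"
  shows "card (verts (delete_verts G (insert u (neighbors G u)))) =
    card (verts G) - Suc (card (neighbors G u))"
proof -
  have "u \<notin> neighbors G u" "insert u (neighbors G u) \<subseteq> verts G"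
    using simple_graph_neighbors(1)[OF assms(1), of u] assms(2) by blast+
  then show ?thesis
    using simple_graph_neighbors(2)[OF assms(1), of u] by (simp add: card_Diff_subset)
qed

text \<open>Stated for forests because deleting a closed neighbourhood may disconnect a
  tree.\<close>

theorem forest_num_two_matchings_le:
  "forest F \<Longrightarrow> num_two_matchings F \<le> path_count (card (verts F))"
proof (induction "card (verts F)" arbitrary: F rule: less_induct)
  case less
  let ?n = "card (verts F)"
  have sg: "simple_graph F" using less.prems by (simp add: forest_def)
  show ?case
  proof (cases "edges F = {}")
    case True
    then show ?thesis using path_count_pos[of ?n] by (simp add: num_two_matchings_no_edges)
  next
    case False
    then obtain u v where leaf: "neighbors F v = {u}"
      using forest_leafE[OF less.prems] by blast
    have uv: "u \<in> verts F" "v \<in> verts F" "u \<noteq> v" "v \<in> neighbors F u"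
      using leafD[OF sg leaf] by auto
    have fin: "finite (verts F)" using sg by (simp add: simple_graph_def)
    have n: "2 \<le> ?n" using card_mono[OF fin, of "{u, v}"] uv by auto
    let ?N = "insert u (neighbors F u)"
    have rec: "num_two_matchings F =
        num_two_matchings (delete_verts F {v}) + num_two_matchings (delete_verts F ?N)"
      by (rule num_two_matchings_leaf[OF sg leaf])
    have cN: "card (verts (delete_verts F ?N)) = ?n - Suc (card (neighbors F u))"
      by (rule card_delete_closed_neighborhood[OF sg uv(1)])
    have N: "num_two_matchings (delete_verts F ?N) \<le> path_count (?n - Suc (card (neighbors F u)))"
      using less.hyps[of "delete_verts F ?N"] forest_delete_verts[OF less.prems] n cN by simp
    show ?thesis
    proof (cases "neighbors F u = {v}")
      \<comment> \<open>Here \<open>{u, v}\<close> is an isolated edge: \<open>u\<close> is left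
        isolated in \<open>F - v\<close>, so both terms of the recursion coincide.\<close>
      case True
      have "num_two_matchings (delete_verts F {v}) = num_two_matchings (delete_verts F ?N)"
      proof (rule num_two_matchings_cong_edges)
        have "e \<inter> ?N = {}" if "e \<in> edges F" "v \<notin> e" for e
          using leaf_edgeD[OF sg True, of e] that True by auto
        then show "edges (delete_verts F {v}) = edges (delete_verts F ?N)"
          using True by auto
      qed (simp_all add: simple_graph_delete_verts sg)
      then have "num_two_matchings F \<le> 2 * path_count (?n - 2)"
        using rec N True by (simp add: numeral_2_eq_2)
      moreover have "?n - 2 + 2 = ?n" using n by simp
      ultimately show ?thesis using twice_path_count_le[of "?n - 2"] by (metis le_trans)
    next
      case False
      then obtain w where "w \<in> neighbors F u" "w \<noteq> v" using uv(4) by blast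
      then have "{v, w} \<subseteq> neighbors F u" "card {v, w} = 2" using uv(4) by auto
      \<comment> \<open>The closed neighbourhood thus has at least three vertices, which matches the
        term \<open>n - 3\<close> of the recursion for paths.\<close>
      then have "2 \<le> card (neighbors F u)"
        by (metis card_mono simple_graph_neighbors(2)[OF sg])
      then have "num_two_matchings (delete_verts F ?N) \<le> path_count (?n - 3)"
        by (intro order.trans[OF N] path_count_mono) simp
      moreover have "num_two_matchings (delete_verts F {v}) \<le> path_count (?n - 1)"
        using less.hyps[of "delete_verts F {v}"] forest_delete_verts[OF less.prems] n uv by simp
      ultimately show ?thesis using rec path_count_rec[OF n] by simp
    qed
  qed
qed

section \<open>Extremal trees\<close>

text \<open>Each term of the recursion for \<open>T\<close> is at most the corresponding term for
  the path, so equality of the sums forces equality in both. The first equality feeds the induction;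
  the second limits the degree of \<open>u\<close>.\<close>

lemma extremal_tree_leaf:
  assumes "tree T" "neighbors T v = {u}" "3 \<le> card (verts T)"
    and "num_two_matchings T = path_count (card (verts T))"
  shows "num_two_matchings (delete_verts T {v}) = path_count (card (verts T) - 1)"
    and "3 \<le> card (neighbors T u) \<Longrightarrow> card (verts T) \<le> 4"
proof -
  let ?n = "card (verts T)" and ?d = "card (neighbors T u)"
  let ?H = "delete_verts T (insert u (neighbors T u))"
  have sg: "simple_graph T" using assms by (simp add: tree_def)
  have uv: "u \<in> verts T" "v \<in> verts T"
    using leafD[OF sg assms(2)] by auto
  have d: "2 \<le> ?d" by (rule tree_leaf_neighbor_degree[OF assms(1-3)])
  have forest: "forest (delete_verts T S)" for S
    by (rule forest_delete_verts[OF tree_imp_forest[OF assms(1)]])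
  have v: "num_two_matchings (delete_verts T {v}) \<le> path_count (?n - 1)"
    using forest_num_two_matchings_le[OF forest, of "{v}"] uv by simp
  have N: "num_two_matchings ?H \<le> path_count (?n - Suc ?d)"
    using forest_num_two_matchings_le[OF forest] card_delete_closed_neighborhood[OF sg uv(1)]
    by metis
  have sum: "num_two_matchings (delete_verts T {v}) + num_two_matchings ?H =
      path_count (?n - 1) + path_count (?n - 3)"
    using num_two_matchings_leaf[OF sg assms(2)] assms(4) path_count_rec[of ?n] assms(3) by simp
  have le: "path_count (?n - Suc ?d) \<le> path_count (?n - 3)"
    using d by (intro path_count_mono) auto
  show "num_two_matchings (delete_verts T {v}) = path_count (?n - 1)"
    using v N sum le by linarith
  have H: "path_count (?n - 3) \<le> num_two_matchings ?H"
    using v sum by linarith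
  show "?n \<le> 4" if "3 \<le> ?d"
  proof (rule ccontr)
    assume "\<not> ?n \<le> 4"
    \<comment> \<open>Strict growth is available from 1 on, hence for at least five vertices. With
      four vertices the counts at 0 and 1 agree, which is how the star escapes.\<close>
    then have "1 \<le> ?n - 4" "Suc (?n - 4) = ?n - 3" by auto
    then have "path_count (?n - 4) < path_count (?n - 3)"
      using path_count_Suc_less[of "?n - 4"] by simp
    moreover have "path_count (?n - Suc ?d) \<le> path_count (?n - 4)"
      using that by (intro path_count_mono) auto
    ultimately show False using N H by linarith
  qed
qed

lemma verts_star [simp]: "verts (complete_bipartite (Suc 0) 3) = {0, 1, 2, 3}"
  by (auto simp: complete_bipartite_def)

lemma star_edge_iff [simp]:
  "{x, y} \<in> edges (complete_bipartite (Suc 0) 3) \<longleftrightarrow> (x = 0 \<and> y \<in> {1, 2, 3}) \<or> (y = 0 \<and> x \<in> {1, 2, 3})"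
  by (auto simp: complete_bipartite_def doubleton_eq_iff)

lemma simple_graph_star: "simple_graph (complete_bipartite 1 3)"
  by (auto simp: simple_graph_def complete_bipartite_def)

text \<open>The centre of the star is 0 and the middle of the path is 1, so the map swaps these
  two.\<close>

lemma graph_isomorphism_path_3:
  "graph_isomorphism (\<lambda>i. if i = 0 then 1 else if i = 1 then 0 else i)
     (path_graph 3) (delete_verts (complete_bipartite 1 3) {3})"
  (is "graph_isomorphism ?g _ _")
proof -
  have verts: "verts (path_graph 3) = {0, 1, 2}"
    "verts (delete_verts (complete_bipartite 1 3) {3}) = {0, 1, 2}"
    by auto
  show ?thesis
    unfolding graph_isomorphism_def verts
  proof (intro conjI ballI)
    show "bij_betw ?g {0, 1, 2} {0, 1, 2}"
      by (auto simp: bij_betw_def inj_on_def)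
    fix x y :: nat assume "x \<in> {0, 1, 2}" "y \<in> {0, 1, 2}"
    then show "{x, y} \<in> edges (path_graph 3) \<longleftrightarrow>
        {?g x, ?g y} \<in> edges (delete_verts (complete_bipartite 1 3) {3})"
      by (elim insertE emptyE) (simp_all del: insert_absorb2)
  qed
qed

lemma three_le_card:
  assumes "finite A" "x \<in> A" "y \<in> A" "z \<in> A" "x \<noteq> y" "x \<noteq> z" "y \<noteq> z"
  shows "3 \<le> card A"
  using card_mono[of A "{x, y, z}"] assms by auto

text \<open>Reduces attaching a leaf at the start of a path to attaching it at the end.\<close>

lemma graph_isomorphism_path_reverse:
  "graph_isomorphism (\<lambda>i. n - 1 - i) (path_graph n) (path_graph n)"
  unfolding graph_isomorphism_def
proof
  show "bij_betw (\<lambda>i. n - 1 - i) (verts (path_graph n)) (verts (path_graph n))"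
    by (rule bij_betw_byWitness[where f' = "\<lambda>i. n - 1 - i"]) auto
qed auto

lemma graph_isomorphism_path_1:
  assumes "simple_graph G" "verts G = {c}"
  shows "graph_isomorphism (\<lambda>_. 0) G (path_graph 1)"
proof -
  have "{c, c} \<notin> edges G" using simple_graph_edgeD(3)[OF assms(1)] by blast
  moreover have "{0, 0} \<notin> edges (path_graph 1)"
    using simple_graph_edgeD(3)[OF simple_graph_path_graph] by blast
  ultimately show ?thesis
    by (simp add: graph_isomorphism_def assms(2) bij_betw_def lessThan_Suc)
qed

text \<open>\<open>Suc (f u) = n\<close> says that \<open>u\<close> is sent to the last vertex of
  the path, the one that the new vertex \<open>n\<close> is joined to.\<close>

lemma graph_iso_path_add_end:
  assumes "simple_graph T" "neighbors T v = {u}"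
    and "graph_isomorphism f (delete_verts T {v}) (path_graph n)" "Suc (f u) = n"
  shows "graph_iso T (path_graph (Suc n))"
proof -
  have "delete_verts (path_graph (Suc n)) {n} = path_graph n"
    using path_graph_delete_last[of "Suc n" n] by simp
  moreover have "neighbors (path_graph (Suc n)) n = {f u}"
    using assms(4) by auto
  ultimately show ?thesis
    using graph_isomorphism_add_leaf[OF assms(1,2) simple_graph_path_graph, of "Suc n" n f] assms(3)
    by (auto simp: graph_iso_iff)
qed

text \<open>A leaf at an end of a path lengthens it. A leaf at an inner vertex creates degree 3,
  which extremality allows only for four vertices, and then the tree is the star.\<close>

lemma extremal_tree_over_path:
  assumes T: "tree T" and leaf: "neighbors T v = {u}" and n: "3 \<le> card (verts T)"
    and ext: "num_two_matchings T = path_count (card (verts T))"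
    and f: "graph_isomorphism f (delete_verts T {v}) (path_graph (card (verts T) - 1))"
  shows "graph_iso T (path_graph (card (verts T))) \<or> graph_iso T (complete_bipartite 1 3)"
proof -
  let ?n = "card (verts T)"
  have sg: "simple_graph T" using T by (simp add: tree_def)
  have uv: "u \<in> verts T" "v \<in> verts T" "u \<noteq> v" "{u, v} \<in> edges T"
    using leafD[OF sg leaf] by auto
  have bij: "bij_betw f (verts T - {v}) {..<?n - 1}"
    and adj: "\<And>x y. x \<in> verts T - {v} \<Longrightarrow> y \<in> verts T - {v} \<Longrightarrow>
      {x, y} \<in> edges T \<longleftrightarrow> {f x, f y} \<in> edges (path_graph (?n - 1))"
    using graph_isomorphism_delete_vertD[OF f] by auto
  have fu: "f u < ?n - 1" using bij uv by (auto simp: bij_betw_def)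
  consider "Suc (f u) = ?n - 1" | "f u = 0" | "0 < f u" "Suc (f u) < ?n - 1"
    using fu by linarith
  then show ?thesis
  proof cases
    case 1
    then show ?thesis using graph_iso_path_add_end[OF sg leaf f] n by simp
  next
    case 2
    then show ?thesis
      using graph_iso_path_add_end[OF sg leaf
          graph_isomorphism_trans[OF f graph_isomorphism_path_reverse]] n by simp
  next
    case 3
    \<comment> \<open>Both path neighbours of \<open>f u\<close> exist; their preimages together
      with \<open>v\<close> are three neighbours of \<open>u\<close>.\<close>
    have "f u - 1 \<in> f ` (verts T - {v})" "Suc (f u) \<in> f ` (verts T - {v})"
      using bij 3 by (auto simp: bij_betw_def)
    then obtain x y where xy: "x \<in> verts T - {v}" "f x = f u - 1" "y \<in> verts T - {v}" "f y = Suc (f u)"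
      by (metis imageE)
    have "3 \<le> card (neighbors T u)"
    proof (rule three_le_card[OF simple_graph_neighbors(2)[OF sg]])
      show "x \<in> neighbors T u" "y \<in> neighbors T u" "v \<in> neighbors T u"
        using xy adj[of u x] adj[of u y] uv 3 by auto
      show "x \<noteq> y" "x \<noteq> v" "y \<noteq> v" using xy by auto
    qed
    then have n4: "?n = 4" and fu1: "f u = 1"
      using extremal_tree_leaf(2)[OF T leaf n ext] 3 by auto
    let ?g = "\<lambda>i. if i = 0 then 1 else if i = 1 then 0 else i :: nat"
    have "graph_isomorphism ?g (path_graph 3) (delete_verts (complete_bipartite 1 3) {3})"
      by (rule graph_isomorphism_path_3)
    then have "graph_isomorphism (?g \<circ> f) (delete_verts T {v})
        (delete_verts (complete_bipartite 1 3) {3})"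
      using graph_isomorphism_trans f n4 by simp
    moreover have "neighbors (complete_bipartite 1 3) 3 = {(?g \<circ> f) u}"
      using fu1 by auto
    ultimately have "graph_isomorphism ((?g \<circ> f)(v := 3)) T (complete_bipartite 1 3)"
      by (rule graph_isomorphism_add_leaf[OF sg leaf simple_graph_star, rotated])
    then show ?thesis unfolding graph_iso_iff by blast
  qed
qed

text \<open>\<open>T\<close> would have five vertices and a leaf whose neighbour has degree at least
  3, against the degree bound for extremal trees.\<close>

lemma not_extremal_over_star:
  assumes T: "tree T" and leaf: "neighbors T v = {u}"
    and ext: "num_two_matchings T = path_count (card (verts T))"
    and f: "graph_isomorphism f (delete_verts T {v}) (complete_bipartite 1 3)"
  shows False
proof -
  have sg: "simple_graph T" using T by (simp add: tree_def)
  have uv: "u \<in> verts T" "v \<in> verts T" "u \<noteq> v"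
    using leafD[OF sg leaf] by auto
  have bij: "bij_betw f (verts T - {v}) {0, 1, 2, 3}"
    and adj: "\<And>x y. x \<in> verts T - {v} \<Longrightarrow> y \<in> verts T - {v} \<Longrightarrow>
      {x, y} \<in> edges T \<longleftrightarrow> {f x, f y} \<in> edges (complete_bipartite 1 3)"
    using graph_isomorphism_delete_vertD[OF f] by simp_all
  have n: "card (verts T) = 5"
    using bij_betw_same_card[OF bij] uv by simp
  have "\<exists>x \<in> verts T - {v}. f x = i" if "i \<in> {0, 1, 2, 3}" for i
    using bij that unfolding bij_betw_def by (metis imageE)
  then obtain g where g: "\<And>i. i \<in> {0, 1, 2, 3} \<Longrightarrow> g i \<in> verts T - {v} \<and> f (g i) = i"
    by metis
  have center: "3 \<le> card (neighbors T (g 0))"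
  proof (rule three_le_card[OF simple_graph_neighbors(2)[OF sg]])
    show "g 1 \<in> neighbors T (g 0)" "g 2 \<in> neighbors T (g 0)" "g 3 \<in> neighbors T (g 0)"
      using g[of 0] g[of 1] g[of 2] g[of 3] adj[of "g 0" "g 1"] adj[of "g 0" "g 2"]
        adj[of "g 0" "g 3"] by auto
    show "g 1 \<noteq> g 2" "g 1 \<noteq> g 3" "g 2 \<noteq> g 3"
      using g[of 1] g[of 2] g[of 3] by auto
  qed
  \<comment> \<open>Some leaf of \<open>T\<close> hangs at the centre: \<open>v\<close> itself, or a leaf of the star other than \<open>u\<close>.\<close>
  have "\<exists>w. neighbors T w = {g 0}"
  proof (cases "u = g 0")
    case False
    have "1 \<noteq> f u \<or> 2 \<noteq> f u" by linarith
    then obtain i where i: "i \<in> {1, 2}" "i \<noteq> f u" by blast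
    have gi: "g i \<in> verts T - {v}" "f (g i) = i" "g 0 \<in> verts T - {v}" "f (g 0) = 0"
      using g[of i] g[of 0] i by auto
    have "x = g 0" if x: "{g i, x} \<in> edges T" for x
    proof -
      \<comment> \<open>The only neighbour of \<open>v\<close> is \<open>u\<close>, and
        \<open>g i\<close> differs from \<open>u\<close> because their images under \<open>f\<close>
        differ.\<close>
      have "x \<noteq> v" using x i gi leaf_edge_iff(2)[OF leaf, of "g i"] by auto
      then have xT: "x \<in> verts T - {v}" using simple_graph_edgeD[OF sg x] by simp
      then have "f x = f (g 0)" using adj[of "g i" x] gi i x by auto
      then show ?thesis using bij xT gi by (auto simp: bij_betw_def inj_on_def)
    qed
    moreover have "{g i, g 0} \<in> edges T" using adj[of "g i" "g 0"] gi i by auto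
    ultimately have "neighbors T (g i) = {g 0}" unfolding neighbors_def by blast
    then show ?thesis by blast
  qed (use leaf in blast)
  then obtain w where "neighbors T w = {g 0}" by blast
  from extremal_tree_leaf(2)[OF T this _ ext center] show False using n by simp
qed

text \<open>Removing a leaf keeps the tree extremal, so by induction \<open>T\<close> arises from a
  path or from the star by attaching a leaf. Orders 1 and 2 are treated separately, since the
  neighbour of a leaf has degree at least 2 only from order 3 on.\<close>

theorem extremal_tree:
  "tree T \<Longrightarrow> num_two_matchings T = path_count (card (verts T)) \<Longrightarrow>
    graph_iso T (path_graph (card (verts T))) \<or> graph_iso T (complete_bipartite 1 3)"
proof (induction "card (verts T)" arbitrary: T rule: less_induct)
  case less
  let ?n = "card (verts T)"
  have sg: "simple_graph T" and con: "connected_graph T"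
    using less.prems by (auto simp: tree_def)
  have fin: "finite (verts T)" using sg by (simp add: simple_graph_def)
  have n: "1 \<le> ?n" using con fin by (auto simp: connected_graph_def Suc_le_eq card_gt_0_iff)
  show ?case
  proof (cases "?n = 1")
    case True
    then obtain c where c: "verts T = {c}" by (auto simp: card_1_singleton_iff)
    then show ?thesis
      using graph_isomorphism_path_1[OF sg c] True unfolding graph_iso_iff by metis
  next
    case False
    then have n2: "2 \<le> ?n" using n by simp
    obtain x where "x \<in> verts T" using con by (auto simp: connected_graph_def)
    then have "edges T \<noteq> {}"
      using tree_neighbors_nonempty[OF less.prems(1) _ n2] by fastforce
    then obtain u v where leaf: "neighbors T v = {u}"
      using forest_leafE[OF tree_imp_forest[OF less.prems(1)]] by blast
    have uv: "u \<in> verts T" "v \<in> verts T" "u \<noteq> v" "{u, v} \<in> edges T"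
      using leafD[OF sg leaf] by auto
    show ?thesis
    proof (cases "?n = 2")
      case True
      have "verts T = {u, v}"
        using uv True fin by (intro card_seteq[symmetric]) auto
      then have "verts (delete_verts T {v}) = {u}" using uv by auto
      from graph_iso_path_add_end[OF sg leaf
          graph_isomorphism_path_1[OF simple_graph_delete_verts[OF sg] this]]
      show ?thesis using True by (simp add: numeral_2_eq_2)
    next
      case False
      then have n3: "3 \<le> ?n" using n2 by simp
      have "graph_iso (delete_verts T {v}) (path_graph (?n - 1)) \<or>
          graph_iso (delete_verts T {v}) (complete_bipartite 1 3)"
        using less.hyps[of "delete_verts T {v}"] tree_delete_leaf[OF less.prems(1) leaf]
          extremal_tree_leaf(1)[OF less.prems(1) leaf n3 less.prems(2)] uv n3 by simp
      then show ?thesis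
        using extremal_tree_over_path[OF less.prems(1) leaf n3 less.prems(2)]
          not_extremal_over_star[OF less.prems(1) leaf less.prems(2)]
        by (auto simp: graph_iso_iff)
    qed
  qed
qed

theorem theorem3p3:
  fixes T :: "'a ugraph" and n :: nat
  assumes "tree T" and "card (verts T) = n"
  shows "num_two_matchings T \<le> num_two_matchings (path_graph n) \<and>
         (num_two_matchings T = num_two_matchings (path_graph n) \<longrightarrow>
            graph_iso T (path_graph n) \<or> graph_iso T (complete_bipartite 1 3))"
  using forest_num_two_matchings_le[OF tree_imp_forest[OF assms(1)]] extremal_tree[OF assms(1)]
    assms(2) by simp

end
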